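(* Every separable inner quasidiagonal $C^*$-algebra is an MF algebra.
   Context: A $C^*$-algebra $A$ is inner quasidiagonal if for all $x_1,\dots,x_n\in A$ and every $\varepsilon>0$ there are a representation $\pi$ of $A$ on a Hilbert space $\mathcal{H}$ and a finite-rank projection $P\in\pi(A)''$ such that $\|P\pi(x_j)-\pi(x_j)P\|<\varepsilon$ and $\|P\pi(x_j)P\|>\|x_j\|-\varepsilon$ for $1\le j\le n$. A separable $C^*$-algebra $A$ is MF (matricial field) if for every finite set $F\subseteq A$ and every $\varepsilon>0$ there are $n\ge 1$ and a $*$-linear map $\varphi:A\to\mathbb{M}_n$ (i.e. a linear map with $\varphi(a^* )=\varphi(a)^*$ for all $a$; no boundedness or positivity is required) such that $\|\varphi(aa')-\varphi(a)\varphi(a')\|<\varepsilon$ and $\|\varphi(a)\|>\|a\|-\varepsilon$ for all $a,a'\in F$. Here $\mathbb{M}_n$ is the $C^*$-algebra of complex $n\times n$ matrices. *)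

theory Defs
  imports "HOL-Analysis.Analysis" "Jordan_Normal_Form.Schur_Decomposition"
begin

unbundle no vec_syntax
no_notation inner (infix "\<bullet>" 70)

class complex_vector = real_vector +
  fixes scaleC :: "complex \<Rightarrow> 'a \<Rightarrow> 'a"  (infixr "*\<^sub>C" 75)
  assumes scaleC_add_right: "c *\<^sub>C (x + y) = c *\<^sub>C x + c *\<^sub>C y"
    and scaleC_add_left: "(c + d) *\<^sub>C x = c *\<^sub>C x + d *\<^sub>C x"
    and scaleC_scaleC: "c *\<^sub>C d *\<^sub>C x = (c * d) *\<^sub>C x"
    and scaleC_one: "1 *\<^sub>C x = x"
    and scaleR_scaleC: "r *\<^sub>R x = complex_of_real r *\<^sub>C x"

interpretation complex_vector: vector_space "scaleC :: complex \<Rightarrow> 'a \<Rightarrow> 'a::complex_vector"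
  by unfold_locales
    (simp_all add: scaleC_add_right scaleC_add_left scaleC_scaleC scaleC_one)

class complex_normed_vector = complex_vector + real_normed_vector +
  assumes norm_scaleC: "norm (c *\<^sub>C x) = cmod c * norm x"

text \<open>A C*-algebra is a whole type of this class. No unit is required, and the zero algebra
  is allowed.\<close>

class cstar_algebra = complex_normed_vector + real_normed_algebra + banach +
  fixes star :: "'a \<Rightarrow> 'a"
  assumes scaleC_mult_left: "(c *\<^sub>C a) * b = c *\<^sub>C (a * b)"
    and scaleC_mult_right: "a * (c *\<^sub>C b) = c *\<^sub>C (a * b)"
    and star_star: "star (star a) = a"
    and star_add: "star (a + b) = star a + star b"
    and star_scaleC: "star (c *\<^sub>C a) = cnj c *\<^sub>C star a"
    and star_mult: "star (a * b) = star b * star a"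
    and cstar_identity: "norm (star a * a) = (norm a)\<^sup>2"

class complex_inner = complex_normed_vector +
  fixes cinner :: "'a \<Rightarrow> 'a \<Rightarrow> complex"
  assumes cinner_commute: "cinner x y = cnj (cinner y x)"
    and cinner_add_right: "cinner x (y + z) = cinner x y + cinner x z"
    and cinner_scaleC_right: "cinner x (c *\<^sub>C y) = c * cinner x y"
    and cinner_ge_zero: "Re (cinner x x) \<ge> 0"
    and cinner_eq_zero_iff: "cinner x x = 0 \<longleftrightarrow> x = 0"
    and norm_eq_sqrt_cinner: "norm x = sqrt (Re (cinner x x))"

text \<open>A Hilbert space is a complete complex subspace \<open>H\<close> of some complex inner product space
  \<open>'h\<close>. Every Hilbert space arises in this way (with \<open>H = UNIV\<close>), and Hilbert spaces of different
  dimensions live in a common type. An operator on \<open>H\<close> is represented by a function on \<open>'h\<close>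
  whose values outside \<open>H\<close> are irrelevant; all notions below only look at its values on \<open>H\<close>.\<close>

definition hilbert_space :: "'h::complex_inner set \<Rightarrow> bool" where
  "hilbert_space H \<longleftrightarrow> complex_vector.subspace H \<and> complete H"

definition bounded_op :: "'h::complex_inner set \<Rightarrow> ('h \<Rightarrow> 'h) \<Rightarrow> bool" where
  "bounded_op H T \<longleftrightarrow>
     (\<forall>x\<in>H. T x \<in> H) \<and>
     (\<forall>x\<in>H. \<forall>y\<in>H. T (x + y) = T x + T y) \<and>
     (\<forall>c. \<forall>x\<in>H. T (c *\<^sub>C x) = c *\<^sub>C T x) \<and>
     (\<exists>K. \<forall>x\<in>H. norm (T x) \<le> K * norm x)"

text \<open>The analogue of \<^const>\<open>onorm\<close> for operators on \<open>H\<close>.\<close>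

definition op_norm :: "'h::complex_inner set \<Rightarrow> ('h \<Rightarrow> 'h) \<Rightarrow> real" where
  "op_norm H T = (SUP x\<in>H. norm (T x) / norm x)"

definition is_adjoint :: "'h::complex_inner set \<Rightarrow> ('h \<Rightarrow> 'h) \<Rightarrow> ('h \<Rightarrow> 'h) \<Rightarrow> bool" where
  "is_adjoint H S T \<longleftrightarrow> (\<forall>x\<in>H. \<forall>y\<in>H. cinner (S x) y = cinner x (T y))"

definition commutant :: "'h::complex_inner set \<Rightarrow> ('h \<Rightarrow> 'h) set \<Rightarrow> ('h \<Rightarrow> 'h) set" where
  "commutant H S = {T. bounded_op H T \<and> (\<forall>R\<in>S. \<forall>x\<in>H. T (R x) = R (T x))}"

definition finite_rank_projection :: "'h::complex_inner set \<Rightarrow> ('h \<Rightarrow> 'h) \<Rightarrow> bool" where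
  "finite_rank_projection H P \<longleftrightarrow>
     bounded_op H P \<and> (\<forall>x\<in>H. P (P x) = P x) \<and> is_adjoint H P P \<and>
     (\<exists>B. finite B \<and> P ` H \<subseteq> complex_vector.span B)"

text \<open>Representations are not required to be nondegenerate.\<close>

definition representation ::
    "'h::complex_inner set \<Rightarrow> ('a::cstar_algebra \<Rightarrow> 'h \<Rightarrow> 'h) \<Rightarrow> bool" where
  "representation H \<pi> \<longleftrightarrow>
     (\<forall>a. bounded_op H (\<pi> a)) \<and>
     (\<forall>a b. \<forall>x\<in>H. \<pi> (a + b) x = \<pi> a x + \<pi> b x) \<and>
     (\<forall>c a. \<forall>x\<in>H. \<pi> (c *\<^sub>C a) x = c *\<^sub>C \<pi> a x) \<and>
     (\<forall>a b. \<forall>x\<in>H. \<pi> (a * b) x = \<pi> a (\<pi> b x)) \<and>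
     (\<forall>a. is_adjoint H (\<pi> (star a)) (\<pi> a))"

text \<open>A definition cannot quantify over types, so the type \<open>'h\<close> in which the Hilbert spaces are
  found is a parameter. The Hilbert space \<open>H\<close> itself depends on the elements \<open>x j\<close> and on
  \<open>\<epsilon>\<close>. As only a set of Hilbert spaces is needed for a given algebra, the algebra is inner
  quasidiagonal iff this holds for some sufficiently large \<open>'h\<close>; a theorem that has
  this as a hypothesis and holds for all \<open>'h\<close> therefore covers all Hilbert spaces.\<close>

definition inner_quasidiagonal ::
    "'a::cstar_algebra itself \<Rightarrow> 'h::complex_inner itself \<Rightarrow> bool" where
  "inner_quasidiagonal (_ :: 'a itself) (_ :: 'h itself) \<longleftrightarrow>
     (\<forall>(n::nat) (x :: nat \<Rightarrow> 'a) \<epsilon>::real. \<epsilon> > 0 \<longrightarrow>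
       (\<exists>(H :: 'h set) \<pi> P.
          hilbert_space H \<and> representation H \<pi> \<and> finite_rank_projection H P \<and>
          P \<in> commutant H (commutant H (range \<pi>)) \<and>
          (\<forall>j\<in>{1..n}.
             op_norm H (\<lambda>v. P (\<pi> (x j) v) - \<pi> (x j) (P v)) < \<epsilon> \<and>
             op_norm H (\<lambda>v. P (\<pi> (x j) (P v))) > norm (x j) - \<epsilon>)))"

definition vec_l2_norm :: "complex vec \<Rightarrow> real" where
  "vec_l2_norm v = sqrt (\<Sum>i<dim_vec v. (cmod (v $ i))\<^sup>2)"

text \<open>The C*-norm of the matrix algebra, i.e. the operator norm with respect to the Euclidean
  norm.\<close>

definition mat_norm :: "complex mat \<Rightarrow> real" where
  "mat_norm A = (SUP v\<in>carrier_vec (dim_col A). vec_l2_norm (A *\<^sub>v v) / vec_l2_norm v)"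

definition star_linear_mat :: "nat \<Rightarrow> ('a::cstar_algebra \<Rightarrow> complex mat) \<Rightarrow> bool" where
  "star_linear_mat n \<phi> \<longleftrightarrow>
     (\<forall>a. \<phi> a \<in> carrier_mat n n) \<and>
     (\<forall>a b. \<phi> (a + b) = \<phi> a + \<phi> b) \<and>
     (\<forall>c a. \<phi> (c *\<^sub>C a) = c \<cdot>\<^sub>m \<phi> a) \<and>
     (\<forall>a. \<phi> (star a) = mat_adjoint (\<phi> a))"

definition MF_algebra :: "'a::cstar_algebra itself \<Rightarrow> bool" where
  "MF_algebra (_ :: 'a itself) \<longleftrightarrow>
     separable_space (euclidean :: 'a topology) \<and>
     (\<forall>(F :: 'a set) \<epsilon>::real. finite F \<longrightarrow> \<epsilon> > 0 \<longrightarrow>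
       (\<exists>n \<phi>. n \<ge> 1 \<and> star_linear_mat n \<phi> \<and>
          (\<forall>a\<in>F. \<forall>b\<in>F. mat_norm (\<phi> (a * b) - \<phi> a * \<phi> b) < \<epsilon>) \<and>
          (\<forall>a\<in>F. mat_norm (\<phi> a) > norm a - \<epsilon>)))"

end

theory Submission
  imports Defs
begin

text \<open>Write \<open>P = V V*\<close> with a partial isometry \<open>V\<close> from \<open>\<complex>\<^sup>n\<close> onto the range of \<open>P\<close>, and
  let \<open>\<phi>(a) = V* \<pi>(a) V\<close>. Since \<open>P V = V\<close>,
  \<open>\<phi>(ab) - \<phi>(a) \<phi>(b) = V* (P \<pi>(a) (1 - P)) ((1 - P) \<pi>(b) P) V\<close>, where both factors are
  cut-downs of the commutators \<open>[P, \<pi>(a)]\<close> and \<open>[P, \<pi>(b)]\<close>. Its norm is therefore at most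
  \<open>\<parallel>[P, \<pi>(a)]\<parallel> \<parallel>[P, \<pi>(b)]\<parallel>\<close>, with no need for \<open>\<pi>\<close> to be contractive. As
  \<open>P \<pi>(a) P = V \<phi>(a) V*\<close>, the norm of \<open>\<phi>(a)\<close> is at least that of \<open>P \<pi>(a) P\<close>.\<close>

section \<open>Complex inner product spaces\<close>

lemma cinner_zero_right [simp]: "cinner x 0 = 0"
  using cinner_add_right[of x 0 0] by simp

lemma cinner_zero_left [simp]: "cinner 0 x = 0"
  using cinner_commute[of 0 x] by simp

lemma cinner_minus_right: "cinner x (- y) = - cinner x y"
  using cinner_add_right[of x y "- y"] by (simp add: add_eq_0_iff2)

lemma cinner_diff_right: "cinner x (y - z) = cinner x y - cinner x z"
  using cinner_add_right[of x y "- z"] by (simp add: cinner_minus_right)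

lemma cinner_add_left: "cinner (x + y) z = cinner x z + cinner y z"
  by (metis cinner_add_right cinner_commute complex_cnj_add)

lemma cinner_scaleC_left: "cinner (c *\<^sub>C x) y = cnj c * cinner x y"
  by (metis cinner_scaleC_right cinner_commute complex_cnj_mult)

lemma cinner_sum_right: "cinner x (\<Sum>i\<in>A. f i) = (\<Sum>i\<in>A. cinner x (f i))"
  by (induction A rule: infinite_finite_induct) (simp_all add: cinner_add_right)

lemma cinner_self: "cinner x x = complex_of_real ((norm x)\<^sup>2)"
proof -
  have "Im (cinner x x) = 0"
    using cinner_commute[of x x] by (metis cnj.simps(2) equal_neg_zero)
  moreover have "Re (cinner x x) = (norm x)\<^sup>2"
    using cinner_ge_zero[of x] by (simp add: norm_eq_sqrt_cinner)
  ultimately show ?thesis by (simp add: complex_eq_iff)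
qed

lemma norm_add_orthogonal:
  assumes "cinner x y = 0"
  shows "(norm (x + y))\<^sup>2 = (norm x)\<^sup>2 + (norm y)\<^sup>2"
proof -
  have "cinner y x = 0" using assms cinner_commute[of y x] by simp
  then have "cinner (x + y) (x + y) = cinner x x + cinner y y"
    using assms by (simp add: cinner_add_left cinner_add_right)
  then show ?thesis
    unfolding cinner_self of_real_add[symmetric] of_real_eq_iff .
qed

lemma norm_sum_orthogonal:
  assumes "finite A" "\<And>i j. i \<noteq> j \<Longrightarrow> cinner (f i) (f j) = 0"
  shows "(norm (\<Sum>i\<in>A. f i))\<^sup>2 = (\<Sum>i\<in>A. (norm (f i))\<^sup>2)"
  using assms(1)
proof (induction A)
  case (insert k A)
  have "cinner (f k) (\<Sum>i\<in>A. f i) = 0"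
    unfolding cinner_sum_right by (rule sum.neutral) (use insert.hyps assms(2) in metis)
  then show ?case using insert by (simp add: norm_add_orthogonal)
qed simp

text \<open>Zero vectors are allowed in the system, so that its length can be taken to be \<open>card B\<close> or
  larger without regard to linear dependence; in particular, a matrix size \<open>n \<ge> 1\<close> is available
  even for \<open>P = 0\<close>.\<close>

lemma exists_orthonormal_system:
  fixes B :: "'h::complex_inner set"
  assumes "finite B"
  shows "\<exists>e :: nat \<Rightarrow> 'h. (\<forall>i. e i \<in> complex_vector.span B) \<and> (\<forall>i. norm (e i) \<le> 1) \<and>
    (\<forall>i j. i \<noteq> j \<longrightarrow> cinner (e i) (e j) = 0) \<and> (\<forall>i\<ge>card B. e i = 0) \<and>
    (\<forall>x\<in>complex_vector.span B. x = (\<Sum>i<card B. cinner (e i) x *\<^sub>C e i))"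
  using assms
proof (induction B)
  case empty
  show ?case by (rule exI[of _ "\<lambda>_. 0"]) simp
next
  case (insert b B)
  from insert.IH obtain e where "\<forall>i. e i \<in> complex_vector.span B" "\<forall>i. norm (e i) \<le> 1"
    "\<forall>i j. i \<noteq> j \<longrightarrow> cinner (e i) (e j) = 0" "\<forall>i\<ge>card B. e i = 0"
    "\<forall>x\<in>complex_vector.span B. x = (\<Sum>i<card B. cinner (e i) x *\<^sub>C e i)"
    by (elim exE conjE)
  note e = this[rule_format]
  let ?n = "card B"
  let ?S = "complex_vector.span (insert b B)"
  define p where "p = (\<Sum>i<?n. cinner (e i) b *\<^sub>C e i)"
  define u where "u = b - p"
  \<comment> \<open>The Gram-Schmidt residual \<open>u\<close>, normalised. If \<open>b\<close>
    already lies in the span of \<open>B\<close>, then \<open>u = 0\<close> and the new slot gets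
    the zero vector, so the length still grows with the cardinality.\<close>
  define w where "w = (if u = 0 then 0 else complex_of_real (1 / norm u) *\<^sub>C u)"
  define e' where "e' = e(?n := w)"
  have p_span: "p \<in> complex_vector.span B"
    unfolding p_def by (intro complex_vector.span_sum complex_vector.span_scale e)
  have eS: "e i \<in> ?S" for i
    using e(1) complex_vector.span_mono[of B "insert b B"] by blast
  have "u \<in> ?S"
    unfolding u_def using p_span complex_vector.span_mono[of B "insert b B"]
    by (intro complex_vector.span_diff) (auto intro: complex_vector.span_base)
  then have wS: "w \<in> ?S"
    unfolding w_def by (auto intro: complex_vector.span_scale complex_vector.span_zero)
  \<comment> \<open>Expanding \<open>e j\<close> in the system itself shows that each
    \<open>e j\<close> is zero or a unit vector; for \<open>j \<ge> ?n\<close> it is zero.\<close>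
  have e_self: "cinner (e j) (e j) *\<^sub>C e j = e j" for j
  proof -
    have "e j = (\<Sum>i<?n. cinner (e i) (e j) *\<^sub>C e i)" by (rule e(5)[OF e(1)])
    also have "\<dots> = (\<Sum>i<?n. if i = j then cinner (e j) (e j) *\<^sub>C e j else 0)"
      by (rule sum.cong) (auto simp: e(3))
    also have "\<dots> = cinner (e j) (e j) *\<^sub>C e j"
      using e(4)[of j] by (auto simp: not_less)
    finally show ?thesis by simp
  qed
  \<comment> \<open>The scalar \<open>cinner (e j) (e j)\<close> may not be 1, but it is real, so it
    can be moved into the left argument and absorbed by \<open>e_self\<close>.\<close>
  have eu: "cinner (e j) u = 0" for j
  proof -
    have "cinner (e j) p = (\<Sum>i<?n. cinner (e i) b * cinner (e j) (e i))"
      by (simp add: p_def cinner_sum_right cinner_scaleC_right)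
    also have "\<dots> = (\<Sum>i<?n. if i = j then cinner (e j) b * cinner (e j) (e j) else 0)"
      by (rule sum.cong) (auto simp: e(3))
    also have "\<dots> = cinner (e j) b * cinner (e j) (e j)"
      using e(4)[of j] by (auto simp: not_less)
    also have "\<dots> = cinner (cinner (e j) (e j) *\<^sub>C e j) b"
      unfolding cinner_scaleC_left by (simp add: cinner_self)
    finally show ?thesis by (simp add: u_def cinner_diff_right e_self)
  qed
  have ew: "cinner (e j) w = 0" for j
    using eu by (simp add: w_def cinner_scaleC_right)
  then have we: "cinner w (e j) = 0" for j
    using cinner_commute[of w "e j"] by simp
  have wB: "cinner w x = 0" if "x \<in> complex_vector.span B" for x
    by (subst e(5)[OF that]) (simp add: cinner_sum_right cinner_scaleC_right we)
  have w_norm: "norm w \<le> 1" by (simp add: w_def norm_scaleC norm_divide)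
  have wu: "cinner w u *\<^sub>C w = u"
    by (simp add: w_def cinner_scaleC_left cinner_self scaleC_scaleC scaleC_one power2_eq_square)
  \<comment> \<open>Split \<open>x = y + k u\<close> with \<open>y\<close> in the span of
    \<open>B\<close>. The old vectors are orthogonal to \<open>u\<close> and \<open>w\<close> is
    orthogonal to \<open>y\<close>, so the two parts are expanded separately.\<close>
  have expand: "x = (\<Sum>i<Suc ?n. cinner (e' i) x *\<^sub>C e' i)" if x_span: "x \<in> ?S" for x
  proof -
    obtain k where "x - k *\<^sub>C b \<in> complex_vector.span B"
      using x_span complex_vector.span_breakdown_eq by metis
    moreover define y where "y = x - k *\<^sub>C b + k *\<^sub>C p"
    ultimately have y: "y \<in> complex_vector.span B"
      using p_span by (auto intro: complex_vector.span_add complex_vector.span_scale)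
    have x: "x = y + k *\<^sub>C u"
      by (simp add: y_def u_def complex_vector.scale_right_diff_distrib)
    have "(\<Sum>i<Suc ?n. cinner (e' i) x *\<^sub>C e' i)
        = (\<Sum>i<?n. cinner (e i) x *\<^sub>C e i) + cinner w x *\<^sub>C w"
      by (simp add: e'_def)
    also have "\<dots> = (\<Sum>i<?n. cinner (e i) y *\<^sub>C e i) + k *\<^sub>C cinner w u *\<^sub>C w"
      by (simp add: x cinner_add_right cinner_scaleC_right eu wB[OF y] scaleC_scaleC)
    also have "\<dots> = x" using e(5)[OF y] x wu by simp
    finally show ?thesis by simp
  qed
  have card: "card (insert b B) = Suc ?n" using insert.hyps by simp
  show ?case
    unfolding card
  proof (intro exI[of _ e'] conjI allI impI ballI)
    show "e' i \<in> ?S" "norm (e' i) \<le> 1" for i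
      using eS wS e(2) w_norm by (simp_all add: e'_def)
    show "cinner (e' i) (e' j) = 0" if "i \<noteq> j" for i j
      using that e(3) ew we by (simp add: e'_def)
    show "e' i = 0" if "Suc ?n \<le> i" for i
      using that e(4) by (simp add: e'_def)
  qed (rule expand)
qed

section \<open>Operator norms\<close>

text \<open>The suprema in \<open>op_norm\<close> and \<open>mat_norm\<close> include the zero
  vector, whose quotient is 0 by the convention for division by zero. A negative \<open>C\<close>
  must therefore be raised to 0.\<close>

lemma divide_le_max_0:
  fixes a b C :: real
  assumes "a \<le> C * b" "0 \<le> b"
  shows "a / b \<le> max C 0"
proof (cases "b = 0")
  case False
  then have "a / b \<le> C" using assms by (simp add: pos_divide_le_eq)
  then show ?thesis by simp
qed simp

lemma bounded_opE:
  assumes "bounded_op H T"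
  obtains K where "\<And>x. x \<in> H \<Longrightarrow> norm (T x) \<le> K * norm x"
  using assms unfolding bounded_op_def by blast

lemma op_norm_bdd_above:
  assumes "bounded_op H T"
  shows "bdd_above ((\<lambda>x. norm (T x) / norm x) ` H)"
proof -
  obtain K where K: "\<And>x. x \<in> H \<Longrightarrow> norm (T x) \<le> K * norm x"
    using assms by (rule bounded_opE) blast
  have "norm (T x) / norm x \<le> max K 0" if "x \<in> H" for x
    by (rule divide_le_max_0) (simp_all add: K that)
  then show ?thesis by (meson bdd_above.I2)
qed

lemma bounded_op_zero:
  assumes "bounded_op H T" "0 \<in> H"
  shows "T 0 = 0"
  using assms by (metis add_cancel_right_right bounded_op_def)

lemma norm_le_op_norm:
  assumes "bounded_op H T" "0 \<in> H" "x \<in> H"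
  shows "norm (T x) \<le> op_norm H T * norm x"
proof (cases "x = 0")
  case False
  have "norm (T x) / norm x \<le> op_norm H T"
    unfolding op_norm_def by (rule cSUP_upper[OF assms(3) op_norm_bdd_above[OF assms(1)]])
  then show ?thesis using False by (simp add: divide_le_eq)
qed (use assms bounded_op_zero in auto)

text \<open>The quotient at the zero vector is 0 and bounds the supremum from below, even if
  \<open>H\<close> is the zero space.\<close>

lemma op_norm_nonneg:
  assumes "bounded_op H T" "0 \<in> H"
  shows "0 \<le> op_norm H T"
  unfolding op_norm_def
  using cSUP_upper[OF assms(2) op_norm_bdd_above[OF assms(1)]] by simp

lemma op_norm_le:
  assumes "0 \<in> H" "0 \<le> C" "\<And>x. x \<in> H \<Longrightarrow> norm (T x) \<le> C * norm x"
  shows "op_norm H T \<le> C"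
  unfolding op_norm_def
proof (rule cSUP_least)
  show "norm (T x) / norm x \<le> C" if "x \<in> H" for x
    using divide_le_max_0[OF assms(3)[OF that]] assms(2) by simp
qed (use assms(1) in auto)

lemma bounded_op_compose:
  assumes "bounded_op H S" "bounded_op H T"
  shows "bounded_op H (\<lambda>x. S (T x))"
proof -
  obtain K where K: "\<And>x. x \<in> H \<Longrightarrow> norm (S x) \<le> K * norm x"
    using assms(1) by (rule bounded_opE) blast
  obtain L where L: "\<And>x. x \<in> H \<Longrightarrow> norm (T x) \<le> L * norm x"
    using assms(2) by (rule bounded_opE) blast
  have "norm (S (T x)) \<le> (max K 0 * L) * norm x" if "x \<in> H" for x
  proof -
    have "norm (S (T x)) \<le> K * norm (T x)"
      using K assms(2) that by (simp add: bounded_op_def)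
    \<comment> \<open>\<open>K\<close> may be negative if \<open>H\<close> is the zero space, so it
      is made nonnegative before the bound for \<open>T\<close> is multiplied by it.\<close>
    also have "\<dots> \<le> max K 0 * norm (T x)" by (simp add: mult_right_mono)
    also have "\<dots> \<le> max K 0 * (L * norm x)" by (simp add: L mult_left_mono that)
    finally show ?thesis by (simp add: mult.assoc)
  qed
  then show ?thesis using assms by (auto simp: bounded_op_def)
qed

lemma bounded_op_diff:
  assumes H: "complex_vector.subspace H" and "bounded_op H S" "bounded_op H T"
  shows "bounded_op H (\<lambda>x. S x - T x)"
proof -
  obtain K where K: "\<And>x. x \<in> H \<Longrightarrow> norm (S x) \<le> K * norm x"
    using assms(2) by (rule bounded_opE) blast
  obtain L where L: "\<And>x. x \<in> H \<Longrightarrow> norm (T x) \<le> L * norm x"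
    using assms(3) by (rule bounded_opE) blast
  have "norm (S x - T x) \<le> (K + L) * norm x" if "x \<in> H" for x
    using norm_triangle_ineq4[of "S x" "T x"] K[OF that] L[OF that] by (simp add: distrib_right)
  then show ?thesis using assms
    by (auto simp: bounded_op_def complex_vector.subspace_diff
        complex_vector.scale_right_diff_distrib)
qed

lemma bounded_op_sum:
  assumes T: "bounded_op H T" and H: "complex_vector.subspace H" and f: "\<And>i. i \<in> A \<Longrightarrow> f i \<in> H"
  shows "T (\<Sum>i\<in>A. c i *\<^sub>C f i) = (\<Sum>i\<in>A. c i *\<^sub>C T (f i))"
  using f
proof (induction A rule: infinite_finite_induct)
  case (insert k A)
  have "(\<Sum>i\<in>A. c i *\<^sub>C f i) \<in> H" "c k *\<^sub>C f k \<in> H"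
    using insert.prems H by (auto intro: complex_vector.subspace_sum complex_vector.subspace_scale)
  with insert T show ?case by (simp add: bounded_op_def)
\<comment> \<open>The empty sum and, by convention, a sum over an infinite set are 0, so both cases
  reduce to \<open>T 0 = 0\<close>.\<close>
qed (use T H in \<open>auto intro: bounded_op_zero complex_vector.subspace_0\<close>)

lemma bounded_op_minus_arg:
  assumes T: "bounded_op H T" and H: "complex_vector.subspace H" and "x \<in> H" "y \<in> H"
  shows "T (x - y) = T x - T y"
proof -
  have "x - y \<in> H" using assms by (simp add: complex_vector.subspace_diff)
  then have "T (x - y + y) = T (x - y) + T y"
    using assms unfolding bounded_op_def by blast
  then show ?thesis by simp
qed

section \<open>The Euclidean norm and the operator norm of matrices\<close>

lemma vec_l2_norm_nonneg [simp]: "0 \<le> vec_l2_norm v"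
  by (simp add: vec_l2_norm_def sum_nonneg)

lemma mat_norm_le:
  assumes "0 \<le> C" "\<And>v. v \<in> carrier_vec (dim_col A) \<Longrightarrow> vec_l2_norm (A *\<^sub>v v) \<le> C * vec_l2_norm v"
  shows "mat_norm A \<le> C"
  unfolding mat_norm_def
proof (rule cSUP_least)
  show "vec_l2_norm (A *\<^sub>v v) / vec_l2_norm v \<le> C" if "v \<in> carrier_vec (dim_col A)" for v
    using divide_le_max_0[OF assms(2)[OF that]] assms(1) by simp
qed (metis zero_carrier_vec empty_iff)

lemma mat_norm_bdd_above:
  assumes "\<And>v. v \<in> carrier_vec (dim_col A) \<Longrightarrow> vec_l2_norm (A *\<^sub>v v) \<le> C * vec_l2_norm v"
  shows "bdd_above ((\<lambda>v. vec_l2_norm (A *\<^sub>v v) / vec_l2_norm v) ` carrier_vec (dim_col A))"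
proof -
  have "vec_l2_norm (A *\<^sub>v v) / vec_l2_norm v \<le> max C 0" if "v \<in> carrier_vec (dim_col A)" for v
    by (rule divide_le_max_0) (simp_all add: assms that)
  then show ?thesis by (meson bdd_above.I2)
qed

text \<open>Any a priori constant \<open>C\<close> makes the set of quotients bounded above, so that
  the supremum is a true bound; it also settles vectors of norm zero. The conclusion then holds with
  the sharper constant \<open>mat_norm A\<close>.\<close>

lemma vec_l2_norm_mult_le:
  assumes bound: "\<And>v. v \<in> carrier_vec (dim_col A) \<Longrightarrow> vec_l2_norm (A *\<^sub>v v) \<le> C * vec_l2_norm v"
    and v: "v \<in> carrier_vec (dim_col A)"
  shows "vec_l2_norm (A *\<^sub>v v) \<le> mat_norm A * vec_l2_norm v"
proof -
  have "vec_l2_norm (A *\<^sub>v v) / vec_l2_norm v \<le> mat_norm A"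
    unfolding mat_norm_def by (rule cSUP_upper[OF v mat_norm_bdd_above[OF bound]])
  then show ?thesis
    using bound[OF v] vec_l2_norm_nonneg[of v] vec_l2_norm_nonneg[of "A *\<^sub>v v"]
    by (cases "vec_l2_norm v = 0") (auto simp: divide_le_eq)
qed

lemma mat_norm_nonneg:
  assumes "\<And>v. v \<in> carrier_vec (dim_col A) \<Longrightarrow> vec_l2_norm (A *\<^sub>v v) \<le> C * vec_l2_norm v"
  shows "0 \<le> mat_norm A"
proof -
  have "0 \<le> vec_l2_norm (A *\<^sub>v 0\<^sub>v (dim_col A)) / vec_l2_norm (0\<^sub>v (dim_col A))" by simp
  also have "\<dots> \<le> mat_norm A"
    unfolding mat_norm_def by (rule cSUP_upper[OF _ mat_norm_bdd_above[OF assms]]) auto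
  finally show ?thesis .
qed

section \<open>Compression to the range of a finite rank projection\<close>

text \<open>The vectors \<open>e i\<close> with \<open>i < n\<close> span the range of
  \<open>P\<close>; each is zero or a unit vector by \<open>P_e\<close> and \<open>P_expand\<close>.
  Idempotence of \<open>P\<close> follows from these assumptions and is derived below as
  \<open>P_idem\<close>.\<close>

locale finite_rank_compression =
  fixes H :: "'h::complex_inner set" and P :: "'h \<Rightarrow> 'h" and e :: "nat \<Rightarrow> 'h" and n :: nat
    and \<pi> :: "'a::cstar_algebra \<Rightarrow> 'h \<Rightarrow> 'h"
  assumes subspace: "complex_vector.subspace H"
    and rep: "representation H \<pi>"
    and P_bounded: "bounded_op H P"
    and P_adjoint: "is_adjoint H P P"
    and e_in: "e i \<in> H"
    and P_e: "P (e i) = e i"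
    and e_norm: "norm (e i) \<le> 1"
    and e_orth: "i \<noteq> j \<Longrightarrow> cinner (e i) (e j) = 0"
    and P_expand: "x \<in> H \<Longrightarrow> P x = (\<Sum>i<n. cinner (e i) (P x) *\<^sub>C e i)"
begin

text \<open>The partial isometry V; it kills the coordinates at which \<open>e i\<close> is
  zero.\<close>

definition lift :: "complex vec \<Rightarrow> 'h" where
  "lift v = (\<Sum>i<n. v $ i *\<^sub>C e i)"

text \<open>The adjoint V* of \<open>lift\<close>, defined on all of \<open>H\<close> and not only
  on the range of \<open>P\<close>.\<close>

definition coords :: "'h \<Rightarrow> complex vec" where
  "coords x = vec n (\<lambda>i. cinner (e i) x)"

text \<open>The map \<phi> of the overview, as the matrix of V* \<pi>(a) V in the standard
  basis.\<close>

definition compression :: "'a \<Rightarrow> complex mat" where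
  "compression a = mat n n (\<lambda>(i, j). cinner (e i) (\<pi> a (e j)))"

lemma zero_in: "0 \<in> H"
  using subspace by (rule complex_vector.subspace_0)

lemma P_in: "x \<in> H \<Longrightarrow> P x \<in> H"
  using P_bounded by (simp add: bounded_op_def)

lemma rep_bounded: "bounded_op H (\<pi> a)"
  using rep by (simp add: representation_def)

lemma rep_in: "x \<in> H \<Longrightarrow> \<pi> a x \<in> H"
  using rep_bounded by (simp add: bounded_op_def)

lemma commutator_bounded: "bounded_op H (\<lambda>v. P (\<pi> a v) - \<pi> a (P v))"
  by (rule bounded_op_diff[OF subspace bounded_op_compose[OF P_bounded rep_bounded]
        bounded_op_compose[OF rep_bounded P_bounded]])

lemma lift_in: "lift v \<in> H"
  unfolding lift_def
  by (intro complex_vector.subspace_sum complex_vector.subspace_scale subspace e_in)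

lemma P_lift: "P (lift v) = lift v"
  unfolding lift_def by (simp add: bounded_op_sum[OF P_bounded subspace] e_in P_e)

lemma cinner_e_P: "x \<in> H \<Longrightarrow> cinner (e i) (P x) = cinner (e i) x"
  using P_adjoint e_in P_e by (metis is_adjoint_def)

text \<open>The factorisation P = V V*. The expansion of \<open>P x\<close> may use the coordinates
  of \<open>x\<close>, because \<open>P\<close> is self-adjoint and fixes each
  \<open>e i\<close>.\<close>

lemma lift_coords: "x \<in> H \<Longrightarrow> lift (coords x) = P x"
  using P_expand[of x] by (simp add: lift_def coords_def cinner_e_P)

lemma coords_carrier [simp]: "coords x \<in> carrier_vec n"
  by (simp add: coords_def)

lemma compression_carrier [simp]: "compression a \<in> carrier_mat n n"
  by (simp add: compression_def)

text \<open>V is a contraction by Pythagoras. Zero vectors among the \<open>e i\<close> are the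
  reason for an inequality instead of an equality.\<close>

lemma norm_lift:
  assumes "v \<in> carrier_vec n"
  shows "norm (lift v) \<le> vec_l2_norm v"
proof -
  have "(norm (lift v))\<^sup>2 = (\<Sum>i<n. (norm (v $ i *\<^sub>C e i))\<^sup>2)"
    unfolding lift_def
    by (rule norm_sum_orthogonal) (simp_all add: cinner_scaleC_left cinner_scaleC_right e_orth)
  also have "\<dots> \<le> (\<Sum>i<n. (cmod (v $ i))\<^sup>2)"
    by (intro sum_mono power_mono) (simp_all add: norm_scaleC e_norm mult_left_le)
  finally show ?thesis
    using assms by (simp add: vec_l2_norm_def real_le_rsqrt)
qed

text \<open>Parseval on the range of \<open>P\<close>. Only the second argument of
  \<open>cinner (P x) (P x)\<close> is expanded, so the norms of the \<open>e i\<close> never enter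
  and zero vectors do no harm.\<close>

lemma norm_coords:
  assumes "x \<in> H"
  shows "vec_l2_norm (coords x) = norm (P x)"
proof -
  have "complex_of_real ((norm (P x))\<^sup>2) = cinner (P x) (P x)" by (simp add: cinner_self)
  also have "\<dots> = (\<Sum>i<n. cinner (e i) (P x) * cinner (P x) (e i))"
    by (subst (2) P_expand[OF assms]) (simp add: cinner_sum_right cinner_scaleC_right)
  also have "\<dots> = (\<Sum>i<n. complex_of_real ((cmod (cinner (e i) x))\<^sup>2))"
  proof (rule sum.cong)
    fix i
    have "cinner (P x) (e i) = cnj (cinner (e i) (P x))" by (rule cinner_commute)
    then show "cinner (e i) (P x) * cinner (P x) (e i) = complex_of_real ((cmod (cinner (e i) x))\<^sup>2)"
      by (simp add: cinner_e_P[OF assms] complex_norm_square del: of_real_power)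
  qed simp
  also have "\<dots> = complex_of_real (\<Sum>i<n. (cmod (cinner (e i) x))\<^sup>2)" by simp
  finally have "(norm (P x))\<^sup>2 = (\<Sum>i<n. (cmod (cinner (e i) x))\<^sup>2)"
    unfolding of_real_eq_iff .
  then show ?thesis by (simp add: vec_l2_norm_def coords_def real_sqrt_unique)
qed

lemma P_idem: "x \<in> H \<Longrightarrow> P (P x) = P x"
  using P_lift lift_coords by metis

text \<open>Pythagoras for the orthogonal decomposition of \<open>x\<close> into \<open>P x\<close>
  and \<open>x - P x\<close>.\<close>

lemma norm_P_le:
  assumes "x \<in> H"
  shows "norm (P x) \<le> norm x"
proof -
  have "cinner (P x) x = cinner (P x) (P x)"
    using P_adjoint assms P_in P_idem by (metis is_adjoint_def)
  then have "cinner (P x) (x - P x) = 0" by (simp add: cinner_diff_right)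
  from norm_add_orthogonal[OF this] have "(norm (P x))\<^sup>2 \<le> (norm x)\<^sup>2" by simp
  then show ?thesis by (simp add: power2_le_iff_abs_le)
qed

lemma norm_coords_le: "x \<in> H \<Longrightarrow> vec_l2_norm (coords x) \<le> norm x"
  by (simp add: norm_coords norm_P_le)

text \<open>Translates the matrix action into V* \<pi>(a) V, so that the norm estimates can be made
  in \<open>H\<close> without matrix entries.\<close>

lemma compression_mult_vec:
  assumes "v \<in> carrier_vec n"
  shows "compression a *\<^sub>v v = coords (\<pi> a (lift v))"
  using assms
  by (intro eq_vecI)
    (auto simp: compression_def coords_def lift_def bounded_op_sum[OF rep_bounded subspace] e_in
      cinner_sum_right cinner_scaleC_right scalar_prod_def atLeast0LessThan mult.commute
      intro!: sum.cong)

lemma star_linear_compression: "star_linear_mat n compression"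
proof -
  have "compression (a + b) = compression a + compression b" for a b
    using rep e_in by (intro eq_matI) (auto simp: compression_def representation_def cinner_add_right)
  moreover have "compression (c *\<^sub>C a) = c \<cdot>\<^sub>m compression a" for c a
    using rep e_in by (intro eq_matI) (auto simp: compression_def representation_def cinner_scaleC_right)
  moreover have "compression (star a) = mat_adjoint (compression a)" for a
  proof (rule eq_matI)
    fix i j assume "i < dim_row (mat_adjoint (compression a))" "j < dim_col (mat_adjoint (compression a))"
    then have ij: "i < n" "j < n" by (simp_all add: compression_def mat_adjoint_def)
    have "cinner (\<pi> (star a) (e j)) (e i) = cinner (e j) (\<pi> a (e i))"
      using rep e_in by (auto simp: representation_def is_adjoint_def)
    then have "cinner (e i) (\<pi> (star a) (e j)) = cnj (cinner (e j) (\<pi> a (e i)))"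
      using cinner_commute by metis
    with ij show "compression (star a) $$ (i, j) = mat_adjoint (compression a) $$ (i, j)"
      by (simp add: compression_def mat_adjoint_def mat_of_rows_index)
  qed (simp_all add: compression_def mat_adjoint_def)
  ultimately show ?thesis by (simp add: star_linear_mat_def)
qed

section \<open>Norm estimates for the compression\<close>

lemma compression_mult_defect:
  "mat_norm (compression (a * b) - compression a * compression b)
    \<le> op_norm H (\<lambda>v. P (\<pi> a v) - \<pi> a (P v)) * op_norm H (\<lambda>v. P (\<pi> b v) - \<pi> b (P v))"
    (is "mat_norm ?D \<le> op_norm H (?C a) * op_norm H (?C b)")
proof (rule mat_norm_le)
  note C = commutator_bounded
  have C_nonneg: "0 \<le> op_norm H (?C c)" for c
    using C zero_in by (rule op_norm_nonneg)
  then show "0 \<le> op_norm H (?C a) * op_norm H (?C b)" by simp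
  fix v :: "complex vec" assume "v \<in> carrier_vec (dim_col ?D)"
  then have v: "v \<in> carrier_vec n" by (simp add: compression_def)
  define u where "u = lift v"
  define y where "y = \<pi> b u"
  define z where "z = y - P y"
  have u: "u \<in> H" unfolding u_def by (rule lift_in)
  have y: "y \<in> H" unfolding y_def by (rule rep_in[OF u])
  have z: "z \<in> H" unfolding z_def by (rule complex_vector.subspace_diff[OF subspace y P_in[OF y]])
  have Pz: "P z = 0"
    by (simp add: z_def bounded_op_minus_arg[OF P_bounded subspace y P_in[OF y]] P_idem[OF y])
  have "?D *\<^sub>v v = compression (a * b) *\<^sub>v v - (compression a * compression b) *\<^sub>v v"
    by (rule minus_mult_distrib_mat_vec[OF compression_carrier _ v])
      (rule mult_carrier_mat[OF compression_carrier compression_carrier])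
  also have "(compression a * compression b) *\<^sub>v v = compression a *\<^sub>v (compression b *\<^sub>v v)"
    by (rule assoc_mult_mat_vec[OF compression_carrier compression_carrier v])
  \<comment> \<open>Multiplicativity of \<pi> gives the first term; in the second,
    \<open>lift_coords\<close> puts \<open>P\<close> between the two factors. The difference leaves
    \<pi>(a) applied to the part \<open>z\<close> of \<open>y\<close> orthogonal to the range of
    \<open>P\<close>.\<close>
  also have "compression (a * b) *\<^sub>v v - \<dots> = coords (\<pi> a y) - coords (\<pi> a (P y))"
    using rep u v lift_coords[OF y]
    by (simp add: compression_mult_vec representation_def flip: u_def y_def)
  also have "\<dots> = coords (\<pi> a z)"
    by (auto simp: z_def coords_def cinner_diff_right
        bounded_op_minus_arg[OF rep_bounded subspace y P_in[OF y]])
  \<comment> \<open>Since \<open>P z = 0\<close>, the commutator at \<open>z\<close> reduces to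
    \<open>P (\<pi> a z)\<close>, whose norm is that of the coordinate vector.\<close>
  finally have "vec_l2_norm (?D *\<^sub>v v) = norm (?C a z)"
    using norm_coords[OF rep_in[OF z]] bounded_op_zero[OF rep_bounded zero_in] by (simp add: Pz)
  also have "\<dots> \<le> op_norm H (?C a) * norm z"
    by (rule norm_le_op_norm[OF C zero_in z])
  \<comment> \<open>Since \<open>P u = u\<close>, the vector \<open>z\<close> is the negative of the
    commutator of \<open>P\<close> and \<open>\<pi> b\<close> at \<open>u\<close>.\<close>
  also have "norm z = norm (?C b u)"
    using P_lift[of v] by (simp add: z_def y_def norm_minus_commute flip: u_def)
  also have "op_norm H (?C a) * norm (?C b u) \<le> op_norm H (?C a) * (op_norm H (?C b) * norm u)"
    by (intro mult_left_mono norm_le_op_norm C zero_in u C_nonneg)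
  also have "\<dots> \<le> op_norm H (?C a) * (op_norm H (?C b) * vec_l2_norm v)"
    unfolding u_def by (intro mult_left_mono norm_lift v C_nonneg)
  finally show "vec_l2_norm (?D *\<^sub>v v) \<le> op_norm H (?C a) * op_norm H (?C b) * vec_l2_norm v"
    by (simp add: mult.assoc)
qed

text \<open>Both outer factors of P \<pi>(a) P = V \<phi>(a) V* are contractions.\<close>

lemma op_norm_le_compression:
  "op_norm H (\<lambda>v. P (\<pi> a (P v))) \<le> mat_norm (compression a)"
proof -
  let ?A = "compression a"
  \<comment> \<open>An a priori bound for the matrix, needed for the supremum in
    \<open>mat_norm\<close> to be finite; \<open>mult\<close> then replaces it by
    \<open>mat_norm ?A\<close>.\<close>
  define K where "K = op_norm H (\<pi> a)"
  have K: "0 \<le> K" unfolding K_def by (rule op_norm_nonneg[OF rep_bounded zero_in])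
  have bound: "vec_l2_norm (?A *\<^sub>v v) \<le> K * vec_l2_norm v" if "v \<in> carrier_vec (dim_col ?A)" for v
  proof -
    have v: "v \<in> carrier_vec n" using that by (simp add: compression_def)
    have "vec_l2_norm (?A *\<^sub>v v) \<le> norm (\<pi> a (lift v))"
      by (simp add: compression_mult_vec[OF v] norm_coords_le rep_in lift_in)
    also have "\<dots> \<le> K * norm (lift v)"
      unfolding K_def by (rule norm_le_op_norm[OF rep_bounded zero_in lift_in])
    also have "\<dots> \<le> K * vec_l2_norm v" by (intro mult_left_mono norm_lift v K)
    finally show ?thesis .
  qed
  have mult: "vec_l2_norm (?A *\<^sub>v v) \<le> mat_norm ?A * vec_l2_norm v" if "v \<in> carrier_vec n" for v
    using vec_l2_norm_mult_le[OF bound] that by (simp add: compression_def)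
  have nonneg: "0 \<le> mat_norm ?A" by (rule mat_norm_nonneg[OF bound])
  show ?thesis
  proof (rule op_norm_le[OF zero_in nonneg])
    fix x assume x: "x \<in> H"
    have "P (\<pi> a (P x)) = lift (?A *\<^sub>v coords x)"
      by (simp add: compression_mult_vec lift_coords x rep_in P_in)
    then have "norm (P (\<pi> a (P x))) \<le> vec_l2_norm (?A *\<^sub>v coords x)"
      using norm_lift[of "?A *\<^sub>v coords x"] by (simp add: mult_mat_vec_carrier[of _ n n])
    also have "\<dots> \<le> mat_norm ?A * vec_l2_norm (coords x)" by (rule mult) simp
    also have "\<dots> \<le> mat_norm ?A * norm x" by (intro mult_left_mono norm_coords_le x nonneg)
    finally show "norm (P (\<pi> a (P x))) \<le> mat_norm ?A * norm x" .
  qed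
qed

end

section \<open>Orthonormal systems for the range of a finite-rank projection\<close>

lemma exists_finite_rank_compression:
  assumes H: "complex_vector.subspace H" and rep: "representation H \<pi>"
    and P: "finite_rank_projection H P"
  obtains e n where "n \<ge> 1" "finite_rank_compression H P e n \<pi>"
proof -
  obtain B where B: "finite B" "P ` H \<subseteq> complex_vector.span B"
    and bP: "bounded_op H P" and PP: "\<And>x. x \<in> H \<Longrightarrow> P (P x) = P x" and aP: "is_adjoint H P P"
    using P by (auto simp: finite_rank_projection_def)
  \<comment> \<open>The spanning set \<open>B\<close> may contain vectors outside the range of
    \<open>P\<close>. A maximal independent subset of the range avoids this, and it is finite
    because it lies in the span of \<open>B\<close>.\<close>
  obtain C where C: "C \<subseteq> P ` H" "complex_vector.independent C" "P ` H \<subseteq> complex_vector.span C"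
    using complex_vector.maximal_independent_subset by blast
  have "finite C"
    using complex_vector.independent_span_bound[OF B(1) C(2)] C(1) B(2) by blast
  from exists_orthonormal_system[OF this] obtain e
    where "\<forall>i. e i \<in> complex_vector.span C" "\<forall>i. norm (e i) \<le> 1"
    "\<forall>i j. i \<noteq> j \<longrightarrow> cinner (e i) (e j) = 0" "\<forall>i\<ge>card C. e i = 0"
    "\<forall>x\<in>complex_vector.span C. x = (\<Sum>i<card C. cinner (e i) x *\<^sub>C e i)"
    by (elim exE conjE)
  note e = this[rule_format]
  \<comment> \<open>Because the range is a subspace, it contains the span of \<open>C\<close> and
    thus every \<open>e i\<close>; hence \<open>P\<close> fixes each \<open>e i\<close>.\<close>
  have sub: "complex_vector.subspace (P ` H)"
  proof (rule complex_vector.subspaceI)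
    show "0 \<in> P ` H"
      using bounded_op_zero[OF bP] complex_vector.subspace_0[OF H] by (metis image_eqI)
  next
    fix x y assume "x \<in> P ` H" "y \<in> P ` H"
    then obtain x' y' where "x' \<in> H" "y' \<in> H" "x = P x'" "y = P y'" by blast
    then have "x + y = P (x' + y')" "x' + y' \<in> H"
      using bP complex_vector.subspace_add[OF H] by (auto simp: bounded_op_def)
    then show "x + y \<in> P ` H" by blast
  next
    fix c x assume "x \<in> P ` H"
    then obtain x' where "x' \<in> H" "x = P x'" by blast
    then have "c *\<^sub>C x = P (c *\<^sub>C x')" "c *\<^sub>C x' \<in> H"
      using bP complex_vector.subspace_scale[OF H] by (auto simp: bounded_op_def)
    then show "c *\<^sub>C x \<in> P ` H" by blast
  qed
  have ePH: "e i \<in> P ` H" for i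
    using e(1) complex_vector.span_minimal[OF C(1) sub] by blast
  have eH: "e i \<in> H" for i
    using ePH[of i] bP by (auto simp: bounded_op_def)
  have Pe: "P (e i) = e i" for i
    using ePH[of i] PP by auto
  \<comment> \<open>The successor ensures \<open>n \<ge> 1\<close> even if \<open>C\<close> is
    empty; the additional vector \<open>e (card C)\<close> is zero and adds nothing to the
    sum.\<close>
  have expand: "P x = (\<Sum>i<Suc (card C). cinner (e i) (P x) *\<^sub>C e i)" if "x \<in> H" for x
    using e(5)[of "P x"] e(4)[of "card C"] C(3) that by auto
  have "finite_rank_compression H P e (Suc (card C)) \<pi>"
    by (intro finite_rank_compression.intro H rep bP aP eH Pe e(2,3) expand)
  then show thesis by (rule that[rotated]) simp
qed

section \<open>Choice of the tolerance and conclusion\<close>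

theorem proposition2p1:
  assumes "separable_space (euclidean :: 'a::cstar_algebra topology)"
    and "inner_quasidiagonal TYPE('a) TYPE('h::complex_inner)"
  shows "MF_algebra TYPE('a)"
  unfolding MF_algebra_def
proof (intro conjI allI impI)
  fix F :: "'a set" and \<epsilon> :: real
  assume "finite F" "\<epsilon> > 0"
  \<comment> \<open>The bound \<delta> \<le> 1 makes the product of two commutator norms at most one
    of them, hence below \<delta> \<le> \<epsilon>; the lower bound on norms uses only \<delta>
    \<le> \<epsilon>.\<close>
  define \<delta> where "\<delta> = min \<epsilon> 1"
  have \<delta>: "\<delta> > 0" "\<delta> \<le> \<epsilon>" "\<delta> \<le> 1" using \<open>\<epsilon> > 0\<close> by (auto simp: \<delta>_def)
  obtain x where x: "bij_betw x {1..card F} F"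
    using ex_bij_betw_nat_finite_1[OF \<open>finite F\<close>] by blast
  obtain H :: "'h set" and \<pi> :: "'a \<Rightarrow> 'h \<Rightarrow> 'h" and P where
    H: "hilbert_space H" "representation H \<pi>" "finite_rank_projection H P"
    and approx: "\<forall>j\<in>{1..card F}. op_norm H (\<lambda>v. P (\<pi> (x j) v) - \<pi> (x j) (P v)) < \<delta> \<and>
      op_norm H (\<lambda>v. P (\<pi> (x j) (P v))) > norm (x j) - \<delta>"
    using assms(2)[unfolded inner_quasidiagonal_def, rule_format, OF \<delta>(1), of "card F" x]
    by (elim exE conjE)
  have F: "op_norm H (\<lambda>v. P (\<pi> a v) - \<pi> a (P v)) < \<delta>"
      "op_norm H (\<lambda>v. P (\<pi> a (P v))) > norm a - \<delta>" if a: "a \<in> F" for a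
  proof -
    obtain j where "j \<in> {1..card F}" "a = x j"
      using a bij_betw_imp_surj_on[OF x] by blast
    with approx show "op_norm H (\<lambda>v. P (\<pi> a v) - \<pi> a (P v)) < \<delta>"
      "op_norm H (\<lambda>v. P (\<pi> a (P v))) > norm a - \<delta>"
      by simp_all
  qed
  have "complex_vector.subspace H" using H(1) by (simp add: hilbert_space_def)
  then obtain e n where "n \<ge> 1" and compression: "finite_rank_compression H P e n \<pi>"
    using H(2,3) by (rule exists_finite_rank_compression)
  interpret finite_rank_compression H P e n \<pi> by (rule compression)
  have defect: "mat_norm (compression (a * b) - compression a * compression b) < \<epsilon>"
    if "a \<in> F" "b \<in> F" for a b
  proof -
    let ?c = "\<lambda>a. op_norm H (\<lambda>v. P (\<pi> a v) - \<pi> a (P v))"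
    have "?c a \<ge> 0"
      by (rule op_norm_nonneg[OF commutator_bounded zero_in])
    then have "?c a * ?c b \<le> ?c a"
      using F(1)[OF \<open>b \<in> F\<close>] \<delta>(3) by (intro mult_left_le) auto
    then show ?thesis
      using compression_mult_defect[of a b] F(1)[OF \<open>a \<in> F\<close>] \<delta>(2) by linarith
  qed
  have lower: "mat_norm (compression a) > norm a - \<epsilon>" if "a \<in> F" for a
    using op_norm_le_compression[of a] F(2)[OF that] \<delta>(2) by linarith
  show "\<exists>n \<phi>. n \<ge> 1 \<and> star_linear_mat n \<phi> \<and>
      (\<forall>a\<in>F. \<forall>b\<in>F. mat_norm (\<phi> (a * b) - \<phi> a * \<phi> b) < \<epsilon>) \<and> (\<forall>a\<in>F. mat_norm (\<phi> a) > norm a - \<epsilon>)"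
    using \<open>n \<ge> 1\<close> star_linear_compression defect lower by blast
qed (fact assms(1))

end
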